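(* Let $k\in\mathbb{N}$, $0<\tau\le 1$, $0<\mu\le 1$, $0\le\tau-\mu<1$, $0\le\delta<1$, $0\le\gamma<1$ and $\tau-\mu+\gamma<1$. Let $f\in\mathcal{P}(k)$, $f(z)=z-\sum_{\nu=k+1}^{\infty}a_\nu z^\nu$ with $a_\nu\ge 0$. Then $f\in\mathcal{P}_{\tau,\mu}(k,\delta,\gamma)$ if and only if $$\sum_{\nu=k+1}^{\infty}\frac{(1+\delta\nu-\delta)\,\Gamma(\nu+\tau)\Gamma(\mu+1)}{\Gamma(\nu+\mu)\Gamma(\tau+1)}\,a_\nu\le 1-\gamma .$$ The inequality is sharp: equality in it is attained for the extremal function $$f(z)=z-\frac{(1-\gamma)(\mu+1)_k}{(1+\delta k)(\tau+1)_k}\,z^{k+1}.$$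
   Context: $\mathbb{U}=\{z\in\mathbb{C}:|z|<1\}$, $\mathbb{N}=\{1,2,3,\dots\}$. For $k\in\mathbb{N}$, $\mathcal{P}(k)$ is the class of functions that are analytic and univalent in $\mathbb{U}$ and of the form $f(z)=z-\sum_{\nu=k+1}^{\infty}a_\nu z^\nu$ with all $a_\nu\ge 0$. Srivastava-Owa fractional derivative: for $0\le\varsigma<1$, $\mathfrak{D}_z^{\varsigma}g(z)=\frac{1}{\Gamma(1-\varsigma)}\frac{d}{dz}\int_0^z g(\zeta)(z-\zeta)^{-\varsigma}\,d\zeta$, where the multiplicity of $(z-\zeta)^{-\varsigma}$ is removed by requiring $\log(z-\zeta)$ to be real when $z-\zeta>0$. Tremblay operator: for $0<\tau\le 1$, $0<\mu\le 1$, $0\le\tau-\mu<1$, $\mathfrak{T}^{\tau,\mu}f(z)=\frac{\Gamma(\mu)}{\Gamma(\tau)}z^{1-\mu}\,\mathfrak{D}_z^{\tau-\mu}\big[z^{\tau-1}f(z)\big]$ for $z\in\mathbb{U}$. (Powers of $z$ and $\zeta$ are taken with the principal branch and the integral along the segment from $0$ to $z$; the resulting function is understood as extended analytically to all of $\mathbb{U}$, including $z=0$ and the negative real axis.) Class $\mathcal{P}_{\tau,\mu}(k,\delta,\gamma)$ (with $0<\tau\le1$, $0<\mu\le1$, $0\le\tau-\mu<1$, $0\le\delta<1$, $0\le\gamma<1$, $\tau-\mu+\gamma<1$): the set of $f\in\mathcal{P}(k)$ such that for all $z\in\mathbb{U}$ $$\Re\left(\frac{\Gamma(\mu+1)\Gamma(\tau)}{\Gamma(\tau+1)\Gamma(\mu)}z^{-1}\left[(1-\delta)\mathfrak{T}^{\tau,\mu}f(z)+\delta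 z\big(\mathfrak{T}^{\tau,\mu}f\big)'(z)\right]\right)>\gamma,$$ the value at $z=0$ being understood by removing the singularity. Pochhammer symbol: $(\lambda)_0=1$ and $(\lambda)_k=\Gamma(\lambda+k)/\Gamma(\lambda)=\lambda(\lambda+1)\cdots(\lambda+k-1)$ for $k\in\mathbb{N}$.
   Formalization: Sharpness is stated as equality for the extremal function's coefficients plus the class's real-part inequality; its univalence (membership in P(k)) is not claimed, since it can fail: k=1, τ=μ=1, δ=γ=0 gives z−z², not univalent in U. *)

theory Defs
  imports "HOL-Complex_Analysis.Complex_Analysis"
begin

abbreviation unit_disc :: "complex set" where
  "unit_disc \<equiv> ball 0 1"

text \<open>
  \<open>f(z) = z - (\<Sum>\<nu>\<ge>k+1. a\<^sub>\<nu> z\<^sup>\<nu>)\<close> on the unit disc with nonnegative coefficients. Only the values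
  \<open>a \<nu>\<close> with \<open>\<nu> \<ge> k + 1\<close> matter. For a power series, convergence at all points of the open
  disc is absolute, so unconditional summation is the same as ordinary summation here.
\<close>

definition neg_coeff_series :: "nat \<Rightarrow> (nat \<Rightarrow> real) \<Rightarrow> (complex \<Rightarrow> complex) \<Rightarrow> bool" where
  "neg_coeff_series k a f \<longleftrightarrow>
     (\<forall>\<nu>\<ge>k+1. 0 \<le> a \<nu>) \<and>
     (\<forall>z\<in>unit_disc. ((\<lambda>\<nu>. of_real (a \<nu>) * z ^ \<nu>) has_sum (z - f z)) {k+1..})"

definition P_class :: "nat \<Rightarrow> (complex \<Rightarrow> complex) set" where
  "P_class k = {f. f holomorphic_on unit_disc \<and> inj_on f unit_disc \<and> (\<exists>a. neg_coeff_series k a f)}"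

text \<open>
  The Srivastava-Owa derivative of order \<open>\<sigma>\<close>, with principal powers and integration along
  the segment from \<open>0\<close> to \<open>w\<close>. For arguments off the nonpositive real axis, \<open>w - \<zeta>\<close> stays off that
  axis along the segment (except at the endpoint \<open>\<zeta> = w\<close>), so no branch cut is met.
\<close>

definition frac_deriv :: "real \<Rightarrow> (complex \<Rightarrow> complex) \<Rightarrow> complex \<Rightarrow> complex" where
  "frac_deriv \<sigma> g z =
     1 / of_real (Gamma (1 - \<sigma>)) *
     deriv (\<lambda>w. contour_integral (linepath 0 w)
                  (\<lambda>\<zeta>. g \<zeta> * (w - \<zeta>) powr of_real (- \<sigma>))) z"

definition tremblay_slit :: "real \<Rightarrow> real \<Rightarrow> (complex \<Rightarrow> complex) \<Rightarrow> complex \<Rightarrow> complex" where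
  "tremblay_slit \<tau> \<mu> f z =
     of_real (Gamma \<mu> / Gamma \<tau>) * z powr of_real (1 - \<mu>) *
     frac_deriv (\<tau> - \<mu>) (\<lambda>\<zeta>. \<zeta> powr of_real (\<tau> - 1) * f \<zeta>) z"

text \<open>
  The principal-branch formula is only meaningful on the disc slit along the nonpositive reals;
  the operator is its analytic extension to the whole disc. By the identity theorem the
  extension is unique on the disc if it exists; values outside the disc are irrelevant.
\<close>

definition tremblay :: "real \<Rightarrow> real \<Rightarrow> (complex \<Rightarrow> complex) \<Rightarrow> complex \<Rightarrow> complex" where
  "tremblay \<tau> \<mu> f =
     (SOME F. F holomorphic_on unit_disc \<and>
              (\<forall>z\<in>unit_disc - \<real>\<^sub>\<le>\<^sub>0. F z = tremblay_slit \<tau> \<mu> f z))"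

text \<open>\<open>remove_sings\<close> gives the value at \<open>z = 0\<close> as the limit there.\<close>

definition tremblay_quot ::
    "real \<Rightarrow> real \<Rightarrow> real \<Rightarrow> (complex \<Rightarrow> complex) \<Rightarrow> complex \<Rightarrow> complex" where
  "tremblay_quot \<tau> \<mu> \<delta> f =
     remove_sings (\<lambda>z.
       of_real (Gamma (\<mu> + 1) * Gamma \<tau> / (Gamma (\<tau> + 1) * Gamma \<mu>)) * inverse z *
       (of_real (1 - \<delta>) * tremblay \<tau> \<mu> f z + of_real \<delta> * z * deriv (tremblay \<tau> \<mu> f) z))"

definition P_tremblay ::
    "real \<Rightarrow> real \<Rightarrow> nat \<Rightarrow> real \<Rightarrow> real \<Rightarrow> (complex \<Rightarrow> complex) set" where
  "P_tremblay \<tau> \<mu> k \<delta> \<gamma> =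
     {f \<in> P_class k. \<forall>z\<in>unit_disc. Re (tremblay_quot \<tau> \<mu> \<delta> f z) > \<gamma>}"

definition coeff_weight :: "real \<Rightarrow> real \<Rightarrow> real \<Rightarrow> nat \<Rightarrow> real" where
  "coeff_weight \<tau> \<mu> \<delta> \<nu> =
     (1 + \<delta> * real \<nu> - \<delta>) * Gamma (real \<nu> + \<tau>) * Gamma (\<mu> + 1) /
     (Gamma (real \<nu> + \<mu>) * Gamma (\<tau> + 1))"

definition extremal_fun ::
    "real \<Rightarrow> real \<Rightarrow> nat \<Rightarrow> real \<Rightarrow> real \<Rightarrow> complex \<Rightarrow> complex" where
  "extremal_fun \<tau> \<mu> k \<delta> \<gamma> z =
     z - of_real ((1 - \<gamma>) * pochhammer (\<mu> + 1) k /
                  ((1 + \<delta> * real k) * pochhammer (\<tau> + 1) k)) * z ^ (k + 1)"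

end

theory Submission
  imports Defs
begin

text \<open>
  Substituting \<open>\<zeta> = t w\<close> turns the fractional integral of \<open>\<zeta> powr (\<tau> - 1) * \<zeta> ^ n\<close> into
  \<open>w powr \<mu> * w ^ n\<close> times a Beta integral, so the Tremblay operator multiplies the \<open>n\<close>-th Taylor
  coefficient by \<open>\<Gamma>(\<mu>) \<Gamma>(n+\<tau>) / (\<Gamma>(\<tau>) \<Gamma>(n+\<mu>))\<close>. The quotient in the class condition is then
  \<open>1 - (\<Sum>\<nu>. A \<nu> * z ^ (\<nu> - 1))\<close>, where \<open>A \<nu>\<close> is the weighted coefficient and is nonnegative.
  Its real part exceeds \<open>\<gamma>\<close> on the disc iff \<open>(\<Sum>\<nu>. A \<nu>) \<le> 1 - \<gamma>\<close>: let \<open>z\<close> tend to \<open>1\<close> along the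
  reals in one direction, and use \<open>\<bar>z ^ (\<nu> - 1)\<bar> \<le> \<bar>z\<bar> < 1\<close> in the other.
\<close>

section \<open>Termwise action of first-order Euler operators\<close>

text \<open>Termwise differentiation, packaged for two uses: \<open>\<mu> + n\<close> arises from
  differentiating the fractional integral, and \<open>(1 - \<delta>) + \<delta> * n\<close> from the
  class condition. The first conclusion turns sums of power series into holomorphic
  functions.\<close>

lemma euler_operator_sums:
  fixes c :: "nat \<Rightarrow> complex" and F :: "complex \<Rightarrow> complex"
  assumes F: "\<And>z. norm z < 1 \<Longrightarrow> (\<lambda>n. c n * z ^ n) sums F z" and z: "norm z < 1"
  shows "(F has_field_derivative deriv F z) (at z)"
    and "(\<lambda>n. (\<alpha> + \<beta> * of_nat n) * c n * z ^ n) sums (\<alpha> * F z + \<beta> * z * deriv F z)"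
proof -
  let ?S = "\<lambda>z. \<Sum>n. c n * z ^ n" and ?D = "\<Sum>n. diffs c n * z ^ n"
  have sm: "\<And>z. norm z < 1 \<Longrightarrow> summable (\<lambda>n. c n * z ^ n)"
    using F sums_summable by blast
  have "(?S has_field_derivative ?D) (at z)"
    using termdiffs_strong'[of 1 c z] sm z by blast
  then have dF: "(F has_field_derivative ?D) (at z)"
  proof (rule has_field_derivative_transform_within_open[where S = unit_disc])
    show "?S x = F x" if "x \<in> unit_disc" for x
      using F[of x] that by (simp add: sums_iff)
  qed (use z in auto)
  then have D: "deriv F z = ?D"
    by (rule DERIV_imp_deriv)
  then show "(F has_field_derivative deriv F z) (at z)"
    using dF by simp
  have "summable (\<lambda>n. diffs c n * z ^ n)"
    using termdiff_converges[of z 1 c] sm z by blast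
  then have "(\<lambda>n. of_nat (Suc n) * c (Suc n) * z ^ n) sums deriv F z"
    unfolding D by (simp add: diffs_def summable_sums)
  then have "(\<lambda>n. z * (of_nat (Suc n) * c (Suc n) * z ^ n)) sums (z * deriv F z)"
    by (rule sums_mult)
  then have "(\<lambda>n. of_nat (Suc n) * c (Suc n) * z ^ Suc n) sums (z * deriv F z)"
    by (simp add: algebra_simps)
  \<comment> \<open>The term at n = 0 vanishes, so the index shift changes nothing.\<close>
  then have zD: "(\<lambda>n. of_nat n * c n * z ^ n) sums (z * deriv F z)"
    using sums_Suc_iff[of "\<lambda>n. of_nat n * c n * z ^ n"] by simp
  show "(\<lambda>n. (\<alpha> + \<beta> * of_nat n) * c n * z ^ n) sums (\<alpha> * F z + \<beta> * z * deriv F z)"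
    using sums_add[OF sums_mult[OF F[OF z], of \<alpha>] sums_mult[OF zD, of \<beta>]]
    by (simp add: algebra_simps)
qed

section \<open>Fractional integrals of power series\<close>

text \<open>The factor \<open>t ^ n\<close> merges into the Beta density and raises its first
  parameter to \<open>p + n\<close>. Sum and integral are exchanged by dominated
  convergence.\<close>

lemma beta_integral_power_series:
  fixes c :: "nat \<Rightarrow> complex"
  assumes f: "\<And>z. norm z < 1 \<Longrightarrow> (\<lambda>n. c n * z ^ n) sums f z"
    and pq: "0 < p" "0 < q" and w: "norm w < 1"
  defines "g \<equiv> \<lambda>t. of_real (t powr (p - 1) * (1 - t) powr (q - 1)) * f (of_real t * w)"
  shows "g integrable_on {0..1}"
    and "(\<lambda>n. of_real (Beta (p + real n) q) * c n * w ^ n) sums integral {0..1} g"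
proof -
  let ?h = "\<lambda>p t::real. t powr (p - 1) * (1 - t) powr (q - 1)"
  let ?G = "\<lambda>n t. of_real (?h (p + real n) t) * (c n * w ^ n) :: complex"
  let ?M = "\<Sum>n. norm (c n * w ^ n)"
  \<comment> \<open>Convergence at a point of larger modulus gives absolute convergence at
    w.\<close>
  obtain r where r: "norm w < r" "r < 1"
    using dense[OF w] by blast
  have r0: "0 < r"
    using r norm_ge_zero[of w] by linarith
  have abs_sm: "summable (\<lambda>n. norm (c n * w ^ n))"
    by (rule powser_insidea[of _ "of_real r"]) (use f[of "of_real r"] r r0 in \<open>auto simp: sums_iff\<close>)
  have I: "(?G n has_integral of_real (Beta (p + real n) q) * (c n * w ^ n)) {0..1}" for n
    by (intro has_integral_mult_left has_integral_of_real has_integral_Beta_real) (use pq in auto)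
  \<comment> \<open>At t = 0 both sides vanish because \<open>0 powr x = 0\<close>, even when n =
    0.\<close>
  have summand: "?G n t = of_real (?h p t) * (c n * (of_real t * w) ^ n)" if "t \<in> {0..1}" for n t
  proof (cases "t = 0")
    case False
    then have "?h (p + real n) t = ?h p t * t ^ n"
      using that by (simp add: powr_diff powr_add powr_realpow field_simps)
    then show ?thesis
      by (simp only: power_mult_distrib of_real_mult of_real_power mult_ac)
  qed simp
  have int: "(\<lambda>t. \<Sum>n<N. ?G n t) integrable_on {0..1}" for N
    using I by (intro integrable_sum) auto
  \<comment> \<open>The majorant is the Beta density times \<open>?M\<close>: for t in [0,1] each
    power series term is at most its norm at t = 1.\<close>
  have hint: "(\<lambda>t. ?h p t * ?M) integrable_on {0..1}"
    using has_integral_Beta_real[OF pq] by (intro integrable_on_mult_left) auto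
  have le: "norm (\<Sum>n<N. ?G n t) \<le> ?h p t * ?M" if t: "t \<in> {0..1}" for N t
  proof -
    have "(\<Sum>n<N. ?G n t) = of_real (?h p t) * (\<Sum>n<N. c n * (of_real t * w) ^ n)"
      unfolding sum_distrib_left by (intro sum.cong refl summand t)
    moreover have "norm (\<Sum>n<N. c n * (of_real t * w) ^ n) \<le> (\<Sum>n<N. norm (c n * w ^ n))"
    proof (rule sum_norm_le)
      fix n
      have "\<bar>t\<bar> ^ n * norm (c n * w ^ n) \<le> 1 * norm (c n * w ^ n)"
        using t by (intro mult_right_mono power_le_one) auto
      then show "norm (c n * (of_real t * w) ^ n) \<le> norm (c n * w ^ n)"
        by (simp add: norm_mult norm_power power_mult_distrib mult_ac)
    qed
    moreover have "(\<Sum>n<N. norm (c n * w ^ n)) \<le> ?M"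
      by (intro sum_le_suminf abs_sm) auto
    ultimately show ?thesis
      by (simp add: norm_mult abs_mult mult_left_mono)
  qed
  have conv: "(\<lambda>N. \<Sum>n<N. ?G n t) \<longlonglongrightarrow> g t" if t: "t \<in> {0..1}" for t
  proof -
    have "norm (of_real t * w) \<le> norm w"
      using t by (simp add: norm_mult mult_left_le_one_le)
    then have "(\<lambda>n. c n * (of_real t * w) ^ n) sums f (of_real t * w)"
      using f w by simp
    then have "(\<lambda>n. of_real (?h p t) * (c n * (of_real t * w) ^ n)) sums g t"
      unfolding g_def by (rule sums_mult)
    then have "(\<lambda>n. ?G n t) sums g t"
      using summand[OF t] by presburger
    then show ?thesis
      by (simp add: sums_def)
  qed
  note dc = dominated_convergence[OF int hint le conv]
  show "g integrable_on {0..1}"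
    by (rule dc(1))
  have "integral {0..1} (\<lambda>t. \<Sum>n<N. ?G n t) = (\<Sum>n<N. of_real (Beta (p + real n) q) * c n * w ^ n)" for N
    using has_integral_sum[of "{..<N}" ?G, OF _ I] by (simp add: integral_unique mult.assoc)
  then show "(\<lambda>n. of_real (Beta (p + real n) q) * c n * w ^ n) sums integral {0..1} g"
    using dc(2) by (simp add: sums_def)
qed

text \<open>Parametrising the segment by \<zeta> = t w reduces the integral to the Beta case with p
  = \<tau> and q = 1 - \<sigma>.\<close>

lemma contour_integral_kernel_power_series:
  fixes c :: "nat \<Rightarrow> complex"
  assumes f: "\<And>z. norm z < 1 \<Longrightarrow> (\<lambda>n. c n * z ^ n) sums f z"
    and \<tau>: "0 < \<tau>" and \<sigma>: "\<sigma> < 1" and w: "norm w < 1" "w \<noteq> 0"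
  shows "contour_integral (linepath 0 w)
           (\<lambda>\<zeta>. \<zeta> powr of_real (\<tau> - 1) * f \<zeta> * (w - \<zeta>) powr of_real (- \<sigma>)) =
         w powr of_real (\<tau> - \<sigma>) * (\<Sum>n. of_real (Beta (\<tau> + real n) (1 - \<sigma>)) * c n * w ^ n)"
proof -
  let ?g = "\<lambda>t. of_real (t powr (\<tau> - 1) * (1 - t) powr ((1 - \<sigma>) - 1)) * f (of_real t * w)"
  let ?k = "\<lambda>\<zeta>. \<zeta> powr of_real (\<tau> - 1) * f \<zeta> * (w - \<zeta>) powr of_real (- \<sigma>)"
  let ?S = "\<Sum>n. of_real (Beta (\<tau> + real n) (1 - \<sigma>)) * c n * w ^ n"
  have q: "0 < 1 - \<sigma>"
    using \<sigma> by simp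
  have g: "(?g has_integral ?S) {0..1}"
    using beta_integral_power_series[OF f \<tau> q w(1)]
    by (metis (no_types, lifting) integrable_integral sums_unique)
  \<comment> \<open>The last factor w comes from d\<zeta> = w dt; the exponents add up to (\<tau> -
    1) - \<sigma> + 1.\<close>
  have pw: "w powr of_real (\<tau> - \<sigma>) = w powr of_real (\<tau> - 1) * w powr of_real (- \<sigma>) * w"
    using w(2) by (simp add: powr_add[symmetric] powr_diff powr_minus field_simps)
  have eq: "?k (linepath 0 w t) * (w - 0) = w powr of_real (\<tau> - \<sigma>) * ?g t" if t: "t \<in> {0<..<1}" for t
  proof -
    have l: "linepath 0 w t = of_real t * w"
      by (simp add: linepath_def scaleR_conv_of_real)
    have l': "w - of_real t * w = of_real (1 - t) * w"
      by (simp add: algebra_simps)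
    \<comment> \<open>Positive real factors split off a principal power for every nonzero w, so the
      identity also holds on the slit.\<close>
    have "(of_real t * w) powr of_real (\<tau> - 1) = of_real (t powr (\<tau> - 1)) * w powr of_real (\<tau> - 1)"
      using t by (subst powr_times_real_left) (auto simp: powr_of_real simp del: of_real_diff)
    moreover have "(of_real (1 - t) * w) powr of_real (- \<sigma>) = of_real ((1 - t) powr (- \<sigma>)) * w powr of_real (- \<sigma>)"
      using t by (subst powr_times_real_left) (auto simp: powr_of_real simp del: of_real_diff of_real_minus)
    ultimately show ?thesis
      unfolding l l' pw by simp
  qed
  have "((\<lambda>t. w powr of_real (\<tau> - \<sigma>) * ?g t) has_integral (w powr of_real (\<tau> - \<sigma>) * ?S)) {0..1}"
    using g by (rule has_integral_mult_right)
  \<comment> \<open>The integrands were compared only on the open interval; the two endpoints do not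
    affect the integral.\<close>
  then have "((\<lambda>t. ?k (linepath 0 w t) * (w - 0)) has_integral (w powr of_real (\<tau> - \<sigma>) * ?S)) {0..1}"
    by (rule has_integral_spike_finite[where S = "{0, 1}", rotated 2]) (simp, rule eq, simp)
  then show ?thesis
    by (intro contour_integral_unique) (simp add: has_contour_integral_linepath)
qed

section \<open>The Tremblay operator on Taylor coefficients\<close>

text \<open>The fractional integral is \<open>w powr \<mu> * F w\<close> with F a power series. The
  product rule gives \<open>z powr (\<mu> - 1)\<close> times
  \<open>\<mu> * F z + z * deriv F z\<close>, and the prefactor \<open>z powr (1 - \<mu>)\<close>
  cancels the power.\<close>

lemma tremblay_slit_power_series:
  fixes c :: "nat \<Rightarrow> complex"
  assumes f: "\<And>z. norm z < 1 \<Longrightarrow> (\<lambda>n. c n * z ^ n) sums f z"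
    and \<tau>: "0 < \<tau>" and \<mu>: "0 < \<mu>" and \<sigma>: "\<tau> - \<mu> < 1"
    and z: "norm z < 1" "z \<notin> \<real>\<^sub>\<le>\<^sub>0"
  shows "(\<lambda>n. of_real (Gamma \<mu> * Gamma (real n + \<tau>) / (Gamma \<tau> * Gamma (real n + \<mu>))) * c n * z ^ n)
           sums tremblay_slit \<tau> \<mu> f z"
proof -
  define \<sigma> where "\<sigma> = \<tau> - \<mu>"
  define b where "b = (\<lambda>n. of_real (Beta (\<tau> + real n) (1 - \<sigma>)) * c n)"
  define F where "F = (\<lambda>w. \<Sum>n. b n * w ^ n)"
  have s1: "\<sigma> < 1"
    using \<open>\<tau> - \<mu> < 1\<close> by (simp add: \<sigma>_def)
  have z0: "z \<noteq> 0"
    using z by auto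
  have F: "(\<lambda>n. b n * w ^ n) sums F w" if "norm w < 1" for w
    using beta_integral_power_series(2)[OF f \<tau> _ that, of "1 - \<sigma>"] s1
    by (auto simp: b_def F_def sums_iff)
  let ?C = "\<lambda>w. contour_integral (linepath 0 w)
    (\<lambda>\<zeta>. \<zeta> powr of_real (\<tau> - 1) * f \<zeta> * (w - \<zeta>) powr of_real (- \<sigma>))"
  have dF: "(F has_field_derivative deriv F z) (at z)"
    by (rule euler_operator_sums(1)[OF F z(1)])
  have "((\<lambda>w. w powr of_real \<mu> * F w) has_field_derivative
      of_real \<mu> * z powr of_real (\<mu> - 1) * F z + z powr of_real \<mu> * deriv F z) (at z)"
    \<comment> \<open>The point z avoids the branch cut, so the principal power is differentiable
      there.\<close>
    by (rule derivative_eq_intros dF refl has_field_derivative_powr z(2) | simp)+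
  then have "(?C has_field_derivative
      of_real \<mu> * z powr of_real (\<mu> - 1) * F z + z powr of_real \<mu> * deriv F z) (at z)"
  proof (rule has_field_derivative_transform_within_open[where S = "unit_disc - {0}"])
    show "w powr of_real \<mu> * F w = ?C w" if "w \<in> unit_disc - {0}" for w
      using contour_integral_kernel_power_series[OF f \<tau> s1, of w] that
      by (simp add: F_def b_def \<sigma>_def)
  qed (use z z0 in auto)
  then have fd: "deriv ?C z = of_real \<mu> * z powr of_real (\<mu> - 1) * F z + z powr of_real \<mu> * deriv F z"
    by (rule DERIV_imp_deriv)
  have "z powr of_real (1 - \<mu>) * deriv ?C z = of_real \<mu> * F z + z * deriv F z"
    unfolding fd using z0 by (simp add: powr_diff field_simps)
  \<comment> \<open>The factor \<open>1 * z\<close> fits \<open>euler_operator_sums\<close> with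
    \<alpha> = \<mu> and \<beta> = 1.\<close>
  then have T: "tremblay_slit \<tau> \<mu> f z =
      of_real (Gamma \<mu> / (Gamma \<tau> * Gamma (1 - \<sigma>))) * (of_real \<mu> * F z + 1 * z * deriv F z)"
    unfolding tremblay_slit_def frac_deriv_def \<sigma>_def by (simp add: field_simps)
  have coeff: "of_real (Gamma \<mu> / (Gamma \<tau> * Gamma (1 - \<sigma>))) * ((of_real \<mu> + 1 * of_nat n) * b n) =
      of_real (Gamma \<mu> * Gamma (real n + \<tau>) / (Gamma \<tau> * Gamma (real n + \<mu>))) * c n" for n
  proof -
    \<comment> \<open>Used with x = n + \<mu> and B = \<open>Gamma (1 - \<sigma>)\<close>: the
      multiplier x from differentiation cancels against Gamma(x + 1) = x Gamma(x) in the denominator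
      of the Beta function.\<close>
    have cancel: "M / (T * B) * (x * (A * B / (x * g))) = M * A / (T * g)"
      if "x > 0" "B > 0" for M T B x A g :: real
      using that by simp
    have "real n + \<mu> > 0" "Gamma (1 - \<sigma>) > 0"
      using s1 \<mu> by (auto intro: Gamma_real_pos)
    moreover have "Gamma (real n + \<mu> + 1) = (real n + \<mu>) * Gamma (real n + \<mu>)"
      using \<open>real n + \<mu> > 0\<close> by (intro Gamma_plus1) (auto elim: nonpos_Ints_cases)
    moreover have "\<tau> + real n + (1 - \<sigma>) = real n + \<mu> + 1"
      by (simp add: \<sigma>_def)
    ultimately have "Gamma \<mu> / (Gamma \<tau> * Gamma (1 - \<sigma>)) * ((\<mu> + real n) * Beta (\<tau> + real n) (1 - \<sigma>)) =
      Gamma \<mu> * Gamma (real n + \<tau>) / (Gamma \<tau> * Gamma (real n + \<mu>))"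
      using cancel[of "real n + \<mu>" "Gamma (1 - \<sigma>)"] by (simp only: Beta_def add.commute[of \<mu>] add.commute[of \<tau>])
    from arg_cong[OF this, of "\<lambda>x. of_real x * c n"] show ?thesis
      unfolding b_def by (simp only: of_real_mult of_real_add of_real_of_nat_eq mult.assoc mult_1)
  qed
  have "(\<lambda>n. of_real (Gamma \<mu> / (Gamma \<tau> * Gamma (1 - \<sigma>))) * ((of_real \<mu> + 1 * of_nat n) * b n * z ^ n))
      sums tremblay_slit \<tau> \<mu> f z"
    unfolding T by (intro sums_mult euler_operator_sums(2) F z)
  then show ?thesis
    by (simp only: mult.assoc[symmetric] coeff[unfolded mult.assoc[symmetric]])
qed

text \<open>The power series G is a holomorphic extension, so the choice in \<open>tremblay\<close>
  is not vacuous; the identity theorem on the connected disc identifies the chosen extension with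
  G.\<close>

lemma tremblay_power_series:
  fixes c :: "nat \<Rightarrow> complex"
  assumes f: "\<And>z. norm z < 1 \<Longrightarrow> (\<lambda>n. c n * z ^ n) sums f z"
    and \<tau>: "0 < \<tau>" and \<mu>: "0 < \<mu>" and \<sigma>: "\<tau> - \<mu> < 1" and z: "norm z < 1"
  shows "(\<lambda>n. of_real (Gamma \<mu> * Gamma (real n + \<tau>) / (Gamma \<tau> * Gamma (real n + \<mu>))) * c n * z ^ n)
           sums tremblay \<tau> \<mu> f z"
proof -
  define b where
    "b = (\<lambda>n. of_real (Gamma \<mu> * Gamma (real n + \<tau>) / (Gamma \<tau> * Gamma (real n + \<mu>))) * c n)"
  define G where "G = (\<lambda>z. \<Sum>n. b n * z ^ n)"
  have slit: "(\<lambda>n. b n * w ^ n) sums tremblay_slit \<tau> \<mu> f w" if "norm w < 1" "w \<notin> \<real>\<^sub>\<le>\<^sub>0" for w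
    unfolding b_def by (rule tremblay_slit_power_series[OF f \<tau> \<mu> \<sigma> that])
  have G: "(\<lambda>n. b n * w ^ n) sums G w" if "norm w < 1" for w
  proof -
    \<comment> \<open>For w on the slit, convergence is inherited from the positive real r, which
      lies off the slit.\<close>
    obtain r where r: "norm w < r" "r < 1"
      using dense[OF \<open>norm w < 1\<close>] by blast
    moreover have r0: "0 < r"
      using r norm_ge_zero[of w] by linarith
    ultimately have "summable (\<lambda>n. b n * w ^ n)"
      by (intro powser_inside[OF sums_summable[OF slit[of "of_real r"]]]) auto
    then show ?thesis
      by (simp add: G_def summable_sums)
  qed
  have "G field_differentiable (at w)" if "norm w < 1" for w
    using euler_operator_sums(1)[OF G that] by (auto simp: field_differentiable_def)
  then have holo: "G holomorphic_on unit_disc"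
    by (simp add: holomorphic_on_def field_differentiable_at_within)
  have Gslit: "\<forall>w\<in>unit_disc - \<real>\<^sub>\<le>\<^sub>0. G w = tremblay_slit \<tau> \<mu> f w"
    using sums_unique2[OF G slit] by simp
  let ?P = "\<lambda>F. F holomorphic_on unit_disc \<and> (\<forall>z\<in>unit_disc - \<real>\<^sub>\<le>\<^sub>0. F z = tremblay_slit \<tau> \<mu> f z)"
  have P: "?P (tremblay \<tau> \<mu> f)"
    unfolding tremblay_def by (rule someI[of ?P G]) (use holo Gslit in auto)
  have "tremblay \<tau> \<mu> f z = G z"
  proof (rule analytic_continuation_open[of "unit_disc - \<real>\<^sub>\<le>\<^sub>0" unit_disc
        "tremblay \<tau> \<mu> f" G])
    show "open (unit_disc - \<real>\<^sub>\<le>\<^sub>0)"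
      by (intro open_Diff) auto
    have "1 / 2 \<in> unit_disc - \<real>\<^sub>\<le>\<^sub>0"
      by (auto simp: complex_nonpos_Reals_iff)
    then show "unit_disc - \<real>\<^sub>\<le>\<^sub>0 \<noteq> {}"
      by blast
  qed (use P holo Gslit z in auto)
  then show ?thesis
    using G[OF z] by (simp add: b_def)
qed

section \<open>The class condition as a coefficient inequality\<close>

text \<open>Since f has no constant term, division by z leaves a power series H with exponents
  lowered by one. Its value at 0 is the limit supplied by \<open>remove_sings\<close>, and the Gamma
  prefactor normalises that value to 1.\<close>

lemma tremblay_quot_has_sum:
  assumes k: "1 \<le> k" and \<tau>: "0 < \<tau>" and \<mu>: "0 < \<mu>" and \<sigma>: "\<tau> - \<mu> < 1"
    and f: "neg_coeff_series k a f" and z: "z \<in> unit_disc"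
  shows "((\<lambda>\<nu>. of_real (coeff_weight \<tau> \<mu> \<delta> \<nu> * a \<nu>) * z ^ (\<nu> - 1))
            has_sum (1 - tremblay_quot \<tau> \<mu> \<delta> f z)) {k+1..}"
proof -
  \<comment> \<open>Full Taylor coefficients of f; below k + 1 the values of a are arbitrary and
    must be masked.\<close>
  define c where "c = (\<lambda>n. complex_of_real (if n = 1 then 1 else if k + 1 \<le> n then - a n else 0))"
  define b where
    "b = (\<lambda>n. of_real (Gamma \<mu> * Gamma (real n + \<tau>) / (Gamma \<tau> * Gamma (real n + \<mu>))) * c n)"
  define C where "C = Gamma (\<mu> + 1) * Gamma \<tau> / (Gamma (\<tau> + 1) * Gamma \<mu>)"
  \<comment> \<open>Coefficients of the quotient, shifted by one: \<open>h n\<close> belongs to the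
    coefficient of f at n + 1.\<close>
  define h where "h = (\<lambda>n. complex_of_real
      (if n = 0 then 1 else if k \<le> n then - (coeff_weight \<tau> \<mu> \<delta> (Suc n) * a (Suc n)) else 0))"
  define H where "H = (\<lambda>z. \<Sum>n. h n * z ^ n)"
  let ?T = "tremblay \<tau> \<mu> f"
  let ?q = "\<lambda>z. of_real C * inverse z * (of_real (1 - \<delta>) * ?T z + of_real \<delta> * z * deriv ?T z)"
  have c_sums: "(\<lambda>n. c n * w ^ n) sums f w" if w: "norm w < 1" for w
  proof -
    have "((\<lambda>\<nu>. of_real (a \<nu>) * w ^ \<nu>) has_sum (w - f w)) {k+1..}"
      using f w by (simp add: neg_coeff_series_def)
    also have "?this \<longleftrightarrow> ((\<lambda>\<nu>. if k + 1 \<le> \<nu> then of_real (a \<nu>) * w ^ \<nu> else 0) has_sum (w - f w)) UNIV"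
      by (rule has_sum_cong_neutral) auto
    finally have "(\<lambda>\<nu>. if k + 1 \<le> \<nu> then of_real (a \<nu>) * w ^ \<nu> else 0) sums (w - f w)"
      by (rule has_sum_imp_sums)
    from sums_diff[OF sums_single[of 1 "\<lambda>n. w ^ n"] this]
    have "(\<lambda>n. (if n = 1 then w ^ n else 0) - (if k + 1 \<le> n then of_real (a n) * w ^ n else 0)) sums f w"
      by simp
    moreover have "(\<lambda>n. (if n = 1 then w ^ n else 0) - (if k + 1 \<le> n then of_real (a n) * w ^ n else 0)) =
        (\<lambda>n. c n * w ^ n)"
      using k by (auto simp: c_def)
    ultimately show ?thesis
      by simp
  qed
  have b_sums: "(\<lambda>n. b n * w ^ n) sums ?T w" if "norm w < 1" for w
    unfolding b_def by (rule tremblay_power_series[OF c_sums \<tau> \<mu> \<sigma> that])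
  have h_eq: "of_real C * ((of_real (1 - \<delta>) + of_real \<delta> * of_nat (Suc n)) * b (Suc n)) = h n" for n
  proof -
    have pos: "Gamma \<mu> > 0" "Gamma \<tau> > 0" "Gamma (\<mu> + 1) > 0" "Gamma (\<tau> + 1) > 0"
      using \<mu> \<tau> by (auto intro!: Gamma_real_pos)
    have "C * ((1 - \<delta> + \<delta> * real (Suc n)) *
        (Gamma \<mu> * Gamma (real (Suc n) + \<tau>) / (Gamma \<tau> * Gamma (real (Suc n) + \<mu>))))
        = coeff_weight \<tau> \<mu> \<delta> (Suc n)"
    proof -
      \<comment> \<open>Here x and y are one number in two arrangements, 1 - \<delta> + \<delta>
        \<nu> and 1 + \<delta> \<nu> - \<delta>.\<close>
      have cancel: "P * T / (Q * M) * (x * (M * A / (T * g))) = y * A * P / (g * Q)"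
        if "M > 0" "T > 0" "x = y" for P T Q M x y A g :: real
        using that by (simp add: mult_ac)
      show ?thesis
        unfolding C_def coeff_weight_def by (rule cancel) (use pos in simp_all)
    qed
    from arg_cong[OF this, of "\<lambda>x. of_real x * c (Suc n)"]
    have "of_real C * ((of_real (1 - \<delta>) + of_real \<delta> * of_nat (Suc n)) * b (Suc n))
        = of_real (coeff_weight \<tau> \<mu> \<delta> (Suc n)) * c (Suc n)"
      unfolding b_def by (simp only: of_real_mult of_real_add of_real_of_nat_eq mult.assoc)
    \<comment> \<open>The weight at \<nu> = 1 produces the constant term 1.\<close>
    moreover have "coeff_weight \<tau> \<mu> \<delta> (Suc 0) = 1"
      using pos by (simp add: coeff_weight_def add.commute)
    ultimately show ?thesis
      using k by (auto simp: h_def c_def)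
  qed
  \<comment> \<open>The origin is excluded because \<open>inverse 0 = 0\<close> would give the
    quotient the value 0 there instead of its limit.\<close>
  have q_sums: "(\<lambda>n. h n * w ^ n) sums ?q w" if w: "norm w < 1" "w \<noteq> 0" for w
  proof -
    have "(\<lambda>n. (of_real (1 - \<delta>) + of_real \<delta> * of_nat n) * b n * w ^ n)
        sums (of_real (1 - \<delta>) * ?T w + of_real \<delta> * w * deriv ?T w)"
      by (rule euler_operator_sums(2)[OF b_sums w(1)])
    moreover have "b 0 = 0"
      by (simp add: b_def c_def)
    ultimately have "(\<lambda>n. (of_real (1 - \<delta>) + of_real \<delta> * of_nat (Suc n)) * b (Suc n) * w ^ Suc n)
        sums (of_real (1 - \<delta>) * ?T w + of_real \<delta> * w * deriv ?T w)"
      by (subst sums_Suc_iff) simp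
    from sums_mult[OF this, of "of_real C * inverse w"]
    show ?thesis
    proof (rule sums_cong[THEN iffD1, rotated])
      show "of_real C * inverse w *
          ((of_real (1 - \<delta>) + of_real \<delta> * of_nat (Suc n)) * b (Suc n) * w ^ Suc n) = h n * w ^ n" for n
        unfolding h_eq[symmetric] using w(2) by simp
    qed
  qed
  have H: "(\<lambda>n. h n * w ^ n) sums H w" if "norm w < 1" for w
  proof (cases "w = 0")
    case True
    then show ?thesis
      using powser_sums_zero[of h] by (simp add: H_def sums_iff)
  next
    case False
    then show ?thesis
      using q_sums that by (simp add: H_def sums_iff)
  qed
  have nz: "norm z < 1"
    using z by simp
  have "isCont H z"
    using euler_operator_sums(1)[OF H nz] DERIV_isCont by blast
  then have "H \<midarrow>z\<rightarrow> H z"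
    by (simp add: isCont_def)
  moreover have "\<forall>\<^sub>F w in at z. H w = ?q w"
  proof -
    have "\<forall>\<^sub>F w in at z. w \<in> unit_disc"
      using z by (intro eventually_at_in_open') auto
    moreover have "\<forall>\<^sub>F w in at z. w \<noteq> 0"
      by (rule eventually_neq_at_within)
    ultimately show ?thesis
      by eventually_elim (rule sums_unique2[OF H q_sums], simp_all)
  qed
  ultimately have "?q \<midarrow>z\<rightarrow> H z"
    by (rule Lim_transform_eventually)
  then have Hz: "tremblay_quot \<tau> \<mu> \<delta> f z = H z"
    unfolding tremblay_quot_def C_def by (rule remove_sings_eqI)
  obtain r where r: "norm z < r" "r < 1"
    using dense[OF nz] by blast
  have "0 < r"
    using r norm_ge_zero[of z] by linarith
  then have "summable (\<lambda>n. norm (h n * z ^ n))"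
    by (intro powser_insidea[of _ "of_real r"]) (use H[of "of_real r"] r in \<open>auto simp: sums_iff\<close>)
  then have "((\<lambda>n. h n * z ^ n) has_sum H z) UNIV"
    using H[OF nz] by (rule norm_summable_imp_has_sum)
  moreover have "((\<lambda>n::nat. if n = 0 then 1 else 0 :: complex) has_sum 1) UNIV"
    by (subst has_sum_cong_neutral[where T = "{0}" and g = "\<lambda>_. 1"]) (auto intro: has_sum_finiteI)
  \<comment> \<open>Subtracting from 1 removes the constant term and flips the sign of the
    others.\<close>
  ultimately have "((\<lambda>n. (if n = 0 then 1 else 0) - h n * z ^ n) has_sum (1 - H z)) UNIV"
    using has_sum_add[of _ UNIV 1 "\<lambda>n. - (h n * z ^ n)" "- H z"] by (simp add: has_sum_uminus)
  also have "?this \<longleftrightarrow> ((\<lambda>n. of_real (coeff_weight \<tau> \<mu> \<delta> (Suc n) * a (Suc n)) * z ^ n) has_sum (1 - H z)) {k..}"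
    by (rule has_sum_cong_neutral) (use k in \<open>auto simp: h_def\<close>)
  also have "\<dots> \<longleftrightarrow> ((\<lambda>\<nu>. of_real (coeff_weight \<tau> \<mu> \<delta> \<nu> * a \<nu>) * z ^ (\<nu> - 1)) has_sum (1 - H z)) {k+1..}"
    by (rule has_sum_reindex_bij_witness[of _ "\<lambda>n. n - 1" Suc]) auto
  finally show ?thesis
    by (simp only: Hz)
qed

lemma Re_gt_iff_sum_le:
  fixes A :: "nat \<Rightarrow> real" and Q :: "complex \<Rightarrow> complex"
  assumes k: "1 \<le> k" and \<gamma>: "\<gamma> < 1" and A: "\<And>\<nu>. \<nu> \<ge> k + 1 \<Longrightarrow> 0 \<le> A \<nu>"
    and Q: "\<And>z. z \<in> unit_disc \<Longrightarrow>
              ((\<lambda>\<nu>. of_real (A \<nu>) * z ^ (\<nu> - 1)) has_sum (1 - Q z)) {k+1..}"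
  shows "(\<forall>z\<in>unit_disc. Re (Q z) > \<gamma>) \<longleftrightarrow>
           A summable_on {k+1..} \<and> (\<Sum>\<^sub>\<infinity>\<nu>\<in>{k+1..}. A \<nu>) \<le> 1 - \<gamma>"
proof (intro iffI conjI ballI)
  assume R: "\<forall>z\<in>unit_disc. Re (Q z) > \<gamma>"
  \<comment> \<open>A finite partial sum is a polynomial in x, so letting x tend to 1 is immediate;
    for x < 1 the nonnegative remaining terms bound it by the full sum.\<close>
  have bd: "sum A F \<le> 1 - \<gamma>" if F: "finite F" "F \<subseteq> {k+1..}" for F
  proof (rule tendsto_upperbound)
    have "((\<lambda>x::real. \<Sum>\<nu>\<in>F. A \<nu> * x ^ (\<nu> - 1)) \<longlongrightarrow> (\<Sum>\<nu>\<in>F. A \<nu> * 1 ^ (\<nu> - 1))) (at_left 1)"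
      by (intro tendsto_intros)
    then show "((\<lambda>x::real. \<Sum>\<nu>\<in>F. A \<nu> * x ^ (\<nu> - 1)) \<longlongrightarrow> sum A F) (at_left 1)"
      by simp
    have "(\<Sum>\<nu>\<in>F. A \<nu> * x ^ (\<nu> - 1)) \<le> 1 - \<gamma>" if x: "x \<in> {0<..<1}" for x
    proof -
      have x': "of_real x \<in> unit_disc"
        using x by simp
      have "((\<lambda>\<nu>. A \<nu> * x ^ (\<nu> - 1)) has_sum (1 - Re (Q (of_real x)))) {k+1..}"
        using has_sum_Re[OF Q[OF x']] by (simp flip: of_real_power of_real_mult)
      then have "(\<Sum>\<nu>\<in>F. A \<nu> * x ^ (\<nu> - 1)) \<le> 1 - Re (Q (of_real x))"
        by (rule finite_sum_le_has_sum) (use F A x in auto)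
      then show ?thesis
        using R x' by fastforce
    qed
    then show "\<forall>\<^sub>F x in at_left 1. (\<Sum>\<nu>\<in>F. A \<nu> * x ^ (\<nu> - 1)) \<le> 1 - \<gamma>"
      using eventually_at_left_real[of 0 1] by (auto elim: eventually_mono)
  qed simp
  show sm: "A summable_on {k+1..}"
    by (rule nonneg_bdd_above_summable_on) (use A bd in \<open>auto intro!: bdd_aboveI2\<close>)
  show "(\<Sum>\<^sub>\<infinity>\<nu>\<in>{k+1..}. A \<nu>) \<le> 1 - \<gamma>"
    using sm bd by (rule infsum_le_finite_sums)
next
  fix z :: complex
  assume S: "A summable_on {k+1..} \<and> (\<Sum>\<^sub>\<infinity>\<nu>\<in>{k+1..}. A \<nu>) \<le> 1 - \<gamma>" and z: "z \<in> unit_disc"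
  have "((\<lambda>\<nu>. A \<nu> * norm z) has_sum ((\<Sum>\<^sub>\<infinity>\<nu>\<in>{k+1..}. A \<nu>) * norm z)) {k+1..}"
    using S by (intro has_sum_cmult_left) auto
  moreover have "Re (of_real (A \<nu>) * z ^ (\<nu> - 1)) \<le> A \<nu> * norm z" if \<nu>: "\<nu> \<in> {k+1..}" for \<nu>
  proof -
    \<comment> \<open>Since \<nu> - 1 is at least k, hence at least 1, a factor
      \<open>norm z\<close> comes out of every term; it makes the final inequality strict.\<close>
    have "norm z ^ (\<nu> - 1) \<le> norm z ^ 1"
      using \<nu> z k by (intro power_decreasing) auto
    then have "norm (of_real (A \<nu>) * z ^ (\<nu> - 1)) \<le> A \<nu> * norm z"
      using A[of \<nu>] \<nu> by (auto simp: norm_mult norm_power intro: mult_left_mono)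
    then show ?thesis
      using complex_Re_le_cmod order_trans by blast
  qed
  ultimately have "Re (1 - Q z) \<le> (\<Sum>\<^sub>\<infinity>\<nu>\<in>{k+1..}. A \<nu>) * norm z"
    by (intro has_sum_mono[OF has_sum_Re[OF Q[OF z]]])
  also have "\<dots> \<le> (1 - \<gamma>) * norm z"
    using S by (intro mult_right_mono) auto
  also have "\<dots> < (1 - \<gamma>) * 1"
    using \<gamma> z by (intro mult_strict_left_mono) auto
  finally show "Re (Q z) > \<gamma>"
    by simp
qed

lemma coeff_weight_pos:
  assumes "0 < \<tau>" "0 < \<mu>" "0 \<le> \<delta>" "1 \<le> \<nu>"
  shows "0 < coeff_weight \<tau> \<mu> \<delta> \<nu>"
proof -
  have "0 \<le> \<delta> * (real \<nu> - 1)"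
    using assms by (intro mult_nonneg_nonneg) auto
  then have "0 < 1 + \<delta> * real \<nu> - \<delta>"
    by (simp add: algebra_simps)
  then show ?thesis
    unfolding coeff_weight_def using assms
    by (intro divide_pos_pos mult_pos_pos Gamma_real_pos) auto
qed

lemma tremblay_quot_gt_iff:
  assumes "1 \<le> k" "0 < \<tau>" "0 < \<mu>" "\<tau> - \<mu> < 1" "0 \<le> \<delta>" "\<gamma> < 1"
    and f: "neg_coeff_series k a f"
  shows "(\<forall>z\<in>unit_disc. Re (tremblay_quot \<tau> \<mu> \<delta> f z) > \<gamma>) \<longleftrightarrow>
           (\<lambda>\<nu>. coeff_weight \<tau> \<mu> \<delta> \<nu> * a \<nu>) summable_on {k+1..} \<and>
           (\<Sum>\<^sub>\<infinity>\<nu>\<in>{k+1..}. coeff_weight \<tau> \<mu> \<delta> \<nu> * a \<nu>) \<le> 1 - \<gamma>"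
proof (rule Re_gt_iff_sum_le)
  show "0 \<le> coeff_weight \<tau> \<mu> \<delta> \<nu> * a \<nu>" if "\<nu> \<ge> k + 1" for \<nu>
    using coeff_weight_pos[of \<tau> \<mu> \<delta> \<nu>] assms that by (auto simp: neg_coeff_series_def)
qed (use assms tremblay_quot_has_sum in auto)

section \<open>Coefficient criterion and sharpness\<close>

text \<open>Sharpness is stated through the coefficients and the real part condition rather than
  membership in \<open>P_tremblay\<close>, since the extremal function can fail to be univalent: for
  \<tau> = \<mu> and \<delta> = \<gamma> = 0 it is z - z^(k+1), whose derivative has zeros in the
  disc.\<close>

theorem theorem1:
  fixes k :: nat and \<tau> \<mu> \<delta> \<gamma> :: real
  assumes "1 \<le> k"
    and "0 < \<tau>" and "\<tau> \<le> 1" and "0 < \<mu>" and "\<mu> \<le> 1"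
    and "0 \<le> \<tau> - \<mu>" and "\<tau> - \<mu> < 1"
    and "0 \<le> \<delta>" and "\<delta> < 1" and "0 \<le> \<gamma>" and "\<gamma> < 1"
    and "\<tau> - \<mu> + \<gamma> < 1"
  shows "(\<forall>f a. f \<in> P_class k \<and> neg_coeff_series k a f \<longrightarrow>
            (f \<in> P_tremblay \<tau> \<mu> k \<delta> \<gamma> \<longleftrightarrow>
               (\<lambda>\<nu>. coeff_weight \<tau> \<mu> \<delta> \<nu> * a \<nu>) summable_on {k+1..} \<and>
               (\<Sum>\<^sub>\<infinity>\<nu>\<in>{k+1..}. coeff_weight \<tau> \<mu> \<delta> \<nu> * a \<nu>) \<le> 1 - \<gamma>)) \<and>
         (\<exists>a. neg_coeff_series k a (extremal_fun \<tau> \<mu> k \<delta> \<gamma>) \<and>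
              ((\<lambda>\<nu>. coeff_weight \<tau> \<mu> \<delta> \<nu> * a \<nu>) has_sum (1 - \<gamma>)) {k+1..}) \<and>
         (\<forall>z\<in>unit_disc. Re (tremblay_quot \<tau> \<mu> \<delta> (extremal_fun \<tau> \<mu> k \<delta> \<gamma>) z) > \<gamma>)"
proof -
  note crit = tremblay_quot_gt_iff[OF \<open>1 \<le> k\<close> \<open>0 < \<tau>\<close> \<open>0 < \<mu>\<close> \<open>\<tau> - \<mu> < 1\<close> \<open>0 \<le> \<delta>\<close> \<open>\<gamma> < 1\<close>]
  define C where
    "C = (1 - \<gamma>) * pochhammer (\<mu> + 1) k / ((1 + \<delta> * real k) * pochhammer (\<tau> + 1) k)"
  \<comment> \<open>A single nonzero coefficient, sized so that its weighted value is exactly 1 -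
    \<gamma>.\<close>
  define a where "a = (\<lambda>\<nu>. if \<nu> = k + 1 then C else 0)"
  have dpos: "1 + \<delta> * real k > 0"
    using \<open>0 \<le> \<delta>\<close> by (simp add: add_pos_nonneg)
  have ppos: "pochhammer (\<mu> + 1) k > 0" "pochhammer (\<tau> + 1) k > 0"
    using \<open>0 < \<mu>\<close> \<open>0 < \<tau>\<close> by (auto intro: pochhammer_pos)
  have single: "((\<lambda>\<nu>. if \<nu> = k + 1 then g \<nu> else 0) has_sum g (k + 1)) {k+1..}"
    for g :: "nat \<Rightarrow> 'b :: real_normed_vector"
    by (subst has_sum_cong_neutral[where T = "{k+1}" and g = g]) (auto intro: has_sum_finiteI)
  have "0 \<le> C"
    unfolding C_def using dpos ppos \<open>\<gamma> < 1\<close> by (intro divide_nonneg_pos mult_nonneg_nonneg mult_pos_pos) auto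
  moreover have "((\<lambda>\<nu>. of_real (a \<nu>) * z ^ \<nu>) has_sum (z - extremal_fun \<tau> \<mu> k \<delta> \<gamma> z)) {k+1..}" for z
  proof -
    have "(\<lambda>\<nu>. of_real (a \<nu>) * z ^ \<nu>) = (\<lambda>\<nu>. if \<nu> = k + 1 then of_real C * z ^ \<nu> else 0)"
      by (auto simp: a_def)
    then show ?thesis
      using single[of "\<lambda>\<nu>. of_real C * z ^ \<nu>"] by (simp add: extremal_fun_def C_def)
  qed
  ultimately have ext: "neg_coeff_series k a (extremal_fun \<tau> \<mu> k \<delta> \<gamma>)"
    by (auto simp: neg_coeff_series_def a_def)
  have poch: "pochhammer (x + 1) k = Gamma (real (k + 1) + x) / Gamma (x + 1)" if "x > 0" for x :: real
    using that by (subst pochhammer_Gamma) (auto simp: add_ac elim: nonpos_Ints_cases)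
  \<comment> \<open>At \<nu> = k + 1 the linear factor is 1 + \<delta> k and the Gamma quotients
    become Pochhammer symbols, making the weight the reciprocal of C up to 1 - \<gamma>.\<close>
  have "coeff_weight \<tau> \<mu> \<delta> (k + 1) =
      (1 + \<delta> * real k) * pochhammer (\<tau> + 1) k / pochhammer (\<mu> + 1) k"
    unfolding poch[OF \<open>0 < \<tau>\<close>] poch[OF \<open>0 < \<mu>\<close>] by (simp add: coeff_weight_def algebra_simps)
  then have W: "coeff_weight \<tau> \<mu> \<delta> (k + 1) * C = 1 - \<gamma>"
    using dpos ppos by (simp add: C_def)
  have "(\<lambda>\<nu>. coeff_weight \<tau> \<mu> \<delta> \<nu> * a \<nu>) =
      (\<lambda>\<nu>. if \<nu> = k + 1 then coeff_weight \<tau> \<mu> \<delta> \<nu> * C else 0)"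
    by (auto simp: a_def)
  then have sharp: "((\<lambda>\<nu>. coeff_weight \<tau> \<mu> \<delta> \<nu> * a \<nu>) has_sum (1 - \<gamma>)) {k+1..}"
    using single[of "\<lambda>\<nu>. coeff_weight \<tau> \<mu> \<delta> \<nu> * C"] W by simp
  \<comment> \<open>The criterion assumes only the coefficient expansion, so it applies to the
    extremal function without univalence.\<close>
  have "\<forall>z\<in>unit_disc. Re (tremblay_quot \<tau> \<mu> \<delta> (extremal_fun \<tau> \<mu> k \<delta> \<gamma>) z) > \<gamma>"
    using crit[OF ext] sharp by (auto simp: summable_on_def infsumI)
  with ext sharp crit show ?thesis
    by (auto simp: P_tremblay_def)
qed

end
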